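(* Let $\mathcal H$ be a complex Hilbert space of dimension at least $2$ (possibly infinite-dimensional). Then there is no nonnegative quasiprobability representation of $\mathcal H$ that satisfies the convex-linearity hypothesis. That is, there do not exist a measure space $\Lambda$ (with measure denoted $d\lambda$), a family of nonnegative real-valued functions $\mu_\rho$ on $\Lambda$, one for each density operator $\rho$ on $\mathcal H$, and a family of nonnegative real-valued functions $\xi_E$ on $\Lambda$, one for each positive Hermitian operator $E$ on $\mathcal H$ with $I-E$ positive, such that (QPR1), (QPR2), (QPR3) and the convex-linearity hypothesis all hold.
   Context: A density operator on $\mathcal H$ is a positive trace-class operator $\rho$ on $\mathcal H$ with $\mathrm{Tr}(\rho)=1$. ``Positive'' means positive semidefinite. A POVM on $\mathcal H$ is a finite family $\{E_k\}$ of positive Hermitian (bounded self-adjoint) operators on $\mathcal H$ with $\sum_k E_k=I$. An operator $E$ is an element of some POVM (a POVM element) if and only if $E$ is positive Hermitian and $I-E$ is positive. The function $\xi_E$ depends only on the operator $E$, not on a POVM containing it. A quasiprobability representation of $\mathcal H$ consists of a measure space $\Lambda$ (a set with a $\sigma$-algebra and a countably additive nonnegative measure $d\lambda$), measurable functions $\mu_\rho:\Lambda\to\mathbb R$ for all density operators $\rho$ on $\mathcal H$, and measurable functions $\xi_E:\Lambda\to\mathbb R$ for all POVM elements $E$ on $\mathcal H$, such that: (QPR1) each $\mu_\rho$ is normalized, i.e. $\mu_\rho$ is integrable and $\int_\Lambda\mu_\rho(\lambda)\,d\lambda=1$; (QPR2) for every POVM $\{E_k\}$, $\sum_k\xi_{E_k}(\lambda)=1$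 for all $\lambda\in\Lambda$; moreover $\xi_I(\lambda)=1$ and $\xi_0(\lambda)=0$ for all $\lambda\in\Lambda$, where $I$ and $0$ are the identity and zero operators; (QPR3) for every density operator $\rho$ and every POVM element $E$, the product $\mu_\rho\,\xi_E$ is integrable and $\mathrm{Tr}(\rho E)=\int_\Lambda\mu_\rho(\lambda)\,\xi_E(\lambda)\,d\lambda$. The representation is nonnegative if all functions $\mu_\rho$ and $\xi_E$ take only nonnegative values. Convex-linearity hypothesis: for every finite family of nonnegative weights $w_j$ with $\sum_j w_j=1$: (i) if $\rho=\sum_j w_j\rho_j$ with all $\rho_j$ density operators, then $\mu_\rho(\lambda)=\sum_j w_j\,\mu_{\rho_j}(\lambda)$ for all $\lambda\in\Lambda$; (ii) if $E=\sum_j w_jE_j$ with all $E_j$ POVM elements, then $\xi_E(\lambda)=\sum_j w_j\,\xi_{E_j}(\lambda)$ for all $\lambda\in\Lambda$. *)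

theory Defs
  imports "HOL-Analysis.Analysis"
begin

section \<open>Complex Hilbert spaces\<close>

text \<open>
  The inner product is antilinear in its first and linear in its second argument. Positive
  definiteness is the compatibility with the norm, and completeness comes from \<open>banach\<close>;
  nothing is assumed about separability or dimension.
\<close>

class complex_hilbert_space = banach +
  fixes scaleC :: "complex \<Rightarrow> 'a \<Rightarrow> 'a"  (infixr "*\<^sub>C" 75)
    and cinner :: "'a \<Rightarrow> 'a \<Rightarrow> complex"
  assumes scaleC_add_right: "a *\<^sub>C (x + y) = a *\<^sub>C x + a *\<^sub>C y"
    and scaleC_add_left: "(a + b) *\<^sub>C x = a *\<^sub>C x + b *\<^sub>C x"
    and scaleC_scaleC: "a *\<^sub>C (b *\<^sub>C x) = (a * b) *\<^sub>C x"
    and scaleC_of_real: "complex_of_real r *\<^sub>C x = r *\<^sub>R x"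
    and cinner_commute: "cinner x y = cnj (cinner y x)"
    and cinner_add_right: "cinner x (y + z) = cinner x y + cinner x z"
    and cinner_scaleC_right: "cinner x (a *\<^sub>C y) = a * cinner x y"
    and cinner_self: "cinner x x = complex_of_real ((norm x)\<^sup>2)"

lemma scaleC_one: "1 *\<^sub>C x = (x :: 'a :: complex_hilbert_space)"
  using scaleC_of_real [of 1 x] by simp

interpretation complex_vector: vector_space "scaleC :: complex \<Rightarrow> 'a \<Rightarrow> 'a :: complex_hilbert_space"
  by unfold_locales (simp_all add: scaleC_add_right scaleC_add_left scaleC_scaleC scaleC_one)

text \<open>
  In an infinite-dimensional space the library's \<open>dim\<close> is \<open>0\<close>, so that case is
  stated separately.
\<close>

definition cdim_at_least :: "nat \<Rightarrow> 'h :: complex_hilbert_space itself \<Rightarrow> bool" where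
  "cdim_at_least n _ \<longleftrightarrow>
     (\<nexists>B :: 'h set. finite B \<and> complex_vector.span B = UNIV) \<or>
     n \<le> complex_vector.dim (UNIV :: 'h set)"

definition is_onb :: "'h :: complex_hilbert_space set \<Rightarrow> bool" where
  "is_onb B \<longleftrightarrow>
     (\<forall>e\<in>B. norm e = 1) \<and>
     (\<forall>e\<in>B. \<forall>f\<in>B. e \<noteq> f \<longrightarrow> cinner e f = 0) \<and>
     closure (complex_vector.span B) = UNIV"


section \<open>Operators\<close>

text \<open>
  Elements of \<open>'h \<Rightarrow>\<^sub>L 'h\<close> are bounded but only real-linear, so complex linearity
  is part of each operator predicate below.
\<close>

definition complex_linear :: "('h :: complex_hilbert_space \<Rightarrow>\<^sub>L 'h) \<Rightarrow> bool" where
  "complex_linear T \<longleftrightarrow> (\<forall>c x. blinfun_apply T (c *\<^sub>C x) = c *\<^sub>C blinfun_apply T x)"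

definition hermitian_op :: "('h :: complex_hilbert_space \<Rightarrow>\<^sub>L 'h) \<Rightarrow> bool" where
  "hermitian_op T \<longleftrightarrow> complex_linear T \<and>
     (\<forall>x y. cinner (blinfun_apply T x) y = cinner x (blinfun_apply T y))"

definition positive_op :: "('h :: complex_hilbert_space \<Rightarrow>\<^sub>L 'h) \<Rightarrow> bool" where
  "positive_op T \<longleftrightarrow> hermitian_op T \<and> (\<forall>x. 0 \<le> Re (cinner x (blinfun_apply T x)))"

text \<open>
  \<open>is_modulus S T\<close> says that \<open>S\<close> is the positive square root of \<open>T\<^sup>* T\<close>: since \<open>S\<close> is
  Hermitian, the second conjunct is \<open>S\<^sup>2 = T\<^sup>* T\<close> tested against all pairs of vectors.
\<close>

definition is_modulus ::
    "('h :: complex_hilbert_space \<Rightarrow>\<^sub>L 'h) \<Rightarrow> ('h \<Rightarrow>\<^sub>L 'h) \<Rightarrow> bool" where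
  "is_modulus S T \<longleftrightarrow> positive_op S \<and>
     (\<forall>x y. cinner (blinfun_apply S x) (blinfun_apply S y) =
            cinner (blinfun_apply T x) (blinfun_apply T y))"

definition trace_class :: "('h :: complex_hilbert_space \<Rightarrow>\<^sub>L 'h) \<Rightarrow> bool" where
  "trace_class T \<longleftrightarrow> complex_linear T \<and>
     (\<exists>S B. is_modulus S T \<and> is_onb B \<and>
        (\<lambda>e. cinner e (blinfun_apply S e)) summable_on B)"

text \<open>
  Only meaningful for trace-class operators, where the sum converges absolutely and does not
  depend on the orthonormal basis.
\<close>

definition op_trace :: "('h :: complex_hilbert_space \<Rightarrow>\<^sub>L 'h) \<Rightarrow> complex" where
  "op_trace T = (\<Sum>\<^sub>\<infinity>e\<in>(SOME B. is_onb B). cinner e (blinfun_apply T e))"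

definition density_op :: "('h :: complex_hilbert_space \<Rightarrow>\<^sub>L 'h) \<Rightarrow> bool" where
  "density_op \<rho> \<longleftrightarrow> positive_op \<rho> \<and> trace_class \<rho> \<and> op_trace \<rho> = 1"

text \<open>Repetitions are allowed in a POVM, so it is a family; any finite family can be indexed by naturals.\<close>

definition povm :: "nat set \<Rightarrow> (nat \<Rightarrow> ('h :: complex_hilbert_space \<Rightarrow>\<^sub>L 'h)) \<Rightarrow> bool" where
  "povm K E \<longleftrightarrow> finite K \<and> (\<forall>k\<in>K. positive_op (E k)) \<and> (\<Sum>k\<in>K. E k) = id_blinfun"

definition povm_element :: "('h :: complex_hilbert_space \<Rightarrow>\<^sub>L 'h) \<Rightarrow> bool" where
  "povm_element E \<longleftrightarrow> positive_op E \<and> positive_op (id_blinfun - E)"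


section \<open>Quasiprobability representations\<close>

text \<open>
  The underlying set of the measure space is \<open>space M\<close>. The values of \<open>\<mu>\<close> and \<open>\<xi>\<close> at
  operators that are not density operators, respectively POVM elements, are unconstrained.
\<close>

definition quasiprobability_representation ::
    "'l measure \<Rightarrow> (('h :: complex_hilbert_space \<Rightarrow>\<^sub>L 'h) \<Rightarrow> 'l \<Rightarrow> real) \<Rightarrow>
     (('h \<Rightarrow>\<^sub>L 'h) \<Rightarrow> 'l \<Rightarrow> real) \<Rightarrow> bool" where
  "quasiprobability_representation M \<mu> \<xi> \<longleftrightarrow>
     (\<forall>\<rho>. density_op \<rho> \<longrightarrow> \<mu> \<rho> \<in> borel_measurable M) \<and>
     (\<forall>E. povm_element E \<longrightarrow> \<xi> E \<in> borel_measurable M) \<and>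
     (\<forall>\<rho>. density_op \<rho> \<longrightarrow> integrable M (\<mu> \<rho>) \<and> (\<integral>l. \<mu> \<rho> l \<partial>M) = 1) \<and>
     (\<forall>K E. povm K E \<longrightarrow> (\<forall>l\<in>space M. (\<Sum>k\<in>K. \<xi> (E k) l) = 1)) \<and>
     (\<forall>l\<in>space M. \<xi> id_blinfun l = 1 \<and> \<xi> 0 l = 0) \<and>
     (\<forall>\<rho> E. density_op \<rho> \<longrightarrow> povm_element E \<longrightarrow>
        integrable M (\<lambda>l. \<mu> \<rho> l * \<xi> E l) \<and>
        op_trace (\<rho> o\<^sub>L E) = complex_of_real (\<integral>l. \<mu> \<rho> l * \<xi> E l \<partial>M))"

definition nonnegative_representation ::
    "'l measure \<Rightarrow> (('h :: complex_hilbert_space \<Rightarrow>\<^sub>L 'h) \<Rightarrow> 'l \<Rightarrow> real) \<Rightarrow>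
     (('h \<Rightarrow>\<^sub>L 'h) \<Rightarrow> 'l \<Rightarrow> real) \<Rightarrow> bool" where
  "nonnegative_representation M \<mu> \<xi> \<longleftrightarrow>
     (\<forall>\<rho>. density_op \<rho> \<longrightarrow> (\<forall>l\<in>space M. 0 \<le> \<mu> \<rho> l)) \<and>
     (\<forall>E. povm_element E \<longrightarrow> (\<forall>l\<in>space M. 0 \<le> \<xi> E l))"

definition convex_linear_representation ::
    "'l measure \<Rightarrow> (('h :: complex_hilbert_space \<Rightarrow>\<^sub>L 'h) \<Rightarrow> 'l \<Rightarrow> real) \<Rightarrow>
     (('h \<Rightarrow>\<^sub>L 'h) \<Rightarrow> 'l \<Rightarrow> real) \<Rightarrow> bool" where
  "convex_linear_representation M \<mu> \<xi> \<longleftrightarrow>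
     (\<forall>(J :: nat set) w. finite J \<longrightarrow> (\<forall>j\<in>J. 0 \<le> w j) \<longrightarrow> (\<Sum>j\<in>J. w j) = 1 \<longrightarrow>
        (\<forall>\<rho> \<rho>s. density_op \<rho> \<longrightarrow> (\<forall>j\<in>J. density_op (\<rho>s j)) \<longrightarrow>
           \<rho> = (\<Sum>j\<in>J. w j *\<^sub>R \<rho>s j) \<longrightarrow>
           (\<forall>l\<in>space M. \<mu> \<rho> l = (\<Sum>j\<in>J. w j * \<mu> (\<rho>s j) l))) \<and>
        (\<forall>E Es. povm_element E \<longrightarrow> (\<forall>j\<in>J. povm_element (Es j)) \<longrightarrow>
           E = (\<Sum>j\<in>J. w j *\<^sub>R Es j) \<longrightarrow>
           (\<forall>l\<in>space M. \<xi> E l = (\<Sum>j\<in>J. w j * \<xi> (Es j) l))))"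

end

theory Submission
  imports Defs
begin

text \<open>
  Write \<open>\<mu>\<^sub>v\<close> for the function of the pure state along \<open>v\<close>. If \<open>v\<close> and \<open>w\<close> are orthogonal, the
  response function of the projection onto \<open>v\<close> is \<open>1\<close> where \<open>\<mu>\<^sub>v > 0\<close> and \<open>0\<close> where \<open>\<mu>\<^sub>w > 0\<close>, so
  \<open>\<mu>\<^sub>v \<mu>\<^sub>w = 0\<close> almost everywhere. By convex-linearity \<open>\<mu>\<^sub>v + \<mu>\<^sub>w\<close> is the same function \<open>c\<close> for all
  orthogonal pairs spanning a fixed plane, hence \<open>\<mu>\<^sub>v\<close> takes only the values \<open>0\<close> and \<open>c\<close>. The states
  along \<open>(2,1)\<close>, \<open>(0,1)\<close>, \<open>(1,0)\<close>, \<open>(1,1)\<close> satisfy \<open>5 P(2,1) + P(0,1) = 2 P(1,0) + 4 P(1,1)\<close>, and the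
  corresponding relation between values in \<open>{0, c}\<close> forces \<open>c = 0\<close>, contradicting normalization.
\<close>

subsection \<open>Inner products\<close>

lemma cinner_add_left: "cinner (x + y) z = cinner x z + cinner (y :: 'h :: complex_hilbert_space) z"
  by (metis cinner_add_right cinner_commute complex_cnj_add)

lemma cinner_scaleC_left: "cinner (a *\<^sub>C x) y = cnj a * cinner (x :: 'h :: complex_hilbert_space) y"
  by (metis cinner_scaleC_right cinner_commute complex_cnj_mult)

lemma cinner_zero_right [simp]: "cinner x 0 = (0 :: complex)" for x :: "'h :: complex_hilbert_space"
  using cinner_add_right[of x 0 0] by simp

lemma cinner_zero_left [simp]: "cinner 0 x = (0 :: complex)" for x :: "'h :: complex_hilbert_space"
  using cinner_add_left[of 0 0 x] by simp

lemma cinner_minus_right: "cinner x (- y) = - cinner x y" for x :: "'h :: complex_hilbert_space"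
  using cinner_add_right[of x y "- y"] by (simp add: add_eq_0_iff)

lemma cinner_diff_right: "cinner x (y - z) = cinner x y - cinner x z"
  for x :: "'h :: complex_hilbert_space"
  using cinner_add_right[of x y "- z"] by (simp add: cinner_minus_right)

lemma cinner_diff_left: "cinner (x - y) z = cinner x z - cinner y z"
  for x :: "'h :: complex_hilbert_space"
  by (metis cinner_diff_right cinner_commute complex_cnj_diff)

lemma cinner_sum_right: "cinner x (\<Sum>i\<in>I. f i) = (\<Sum>i\<in>I. cinner x (f i))"
  for x :: "'h :: complex_hilbert_space"
  by (induction I rule: infinite_finite_induct) (simp_all add: cinner_add_right)

lemma cinner_sum_left: "cinner (\<Sum>i\<in>I. f i) x = (\<Sum>i\<in>I. cinner (f i) x)"
  for x :: "'h :: complex_hilbert_space"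
  by (induction I rule: infinite_finite_induct) (simp_all add: cinner_add_left)

lemma cinner_eq_0_commute: "cinner x y = 0 \<longleftrightarrow> cinner y x = 0"
  for x :: "'h :: complex_hilbert_space"
  by (metis cinner_commute complex_cnj_zero)

lemma cinner_mult_cinner_commute: "cinner x y * cinner y x = complex_of_real ((cmod (cinner x y))\<^sup>2)"
  for x :: "'h :: complex_hilbert_space"
  by (metis cinner_commute complex_norm_square)

lemma norm_scaleC: "norm (a *\<^sub>C x) = cmod a * norm x" for x :: "'h :: complex_hilbert_space"
proof -
  have "complex_of_real ((norm (a *\<^sub>C x))\<^sup>2) = cnj a * a * complex_of_real ((norm x)\<^sup>2)"
    by (simp only: cinner_self[symmetric] cinner_scaleC_left cinner_scaleC_right ac_simps)
  also have "\<dots> = complex_of_real ((cmod a * norm x)\<^sup>2)"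
    by (simp only: mult.commute[of "cnj a"] complex_norm_square[symmetric] power_mult_distrib of_real_mult)
  finally show ?thesis
    by (simp only: of_real_eq_iff) simp
qed

lemma power2_norm_add_orthogonal:
  fixes x y :: "'h :: complex_hilbert_space"
  assumes "cinner x y = 0"
  shows "(norm (x + y))\<^sup>2 = (norm x)\<^sup>2 + (norm y)\<^sup>2"
proof -
  have "complex_of_real ((norm (x + y))\<^sup>2) = complex_of_real ((norm x)\<^sup>2 + (norm y)\<^sup>2)"
    using assms cinner_eq_0_commute[of x y]
    by (simp only: cinner_self[symmetric] cinner_add_left cinner_add_right of_real_add) simp
  then show ?thesis by (simp only: of_real_eq_iff)
qed

lemma power2_norm_sum_orthogonal:
  fixes f :: "'i \<Rightarrow> 'h :: complex_hilbert_space"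
  assumes "finite F" "\<And>i j. i \<in> F \<Longrightarrow> j \<in> F \<Longrightarrow> i \<noteq> j \<Longrightarrow> cinner (f i) (f j) = 0"
  shows "(norm (\<Sum>i\<in>F. f i))\<^sup>2 = (\<Sum>i\<in>F. (norm (f i))\<^sup>2)"
  using assms
proof (induction F rule: finite_induct)
  case (insert i F)
  have "cinner (f i) (\<Sum>i\<in>F. f i) = 0"
    unfolding cinner_sum_right using insert.hyps insert.prems by (intro sum.neutral) auto
  with insert show ?case by (simp add: power2_norm_add_orthogonal)
qed simp

text \<open>Subtracting \<open>c *\<^sub>C x\<close>, the component of \<open>y\<close> along
  \<open>x\<close>, leaves a vector orthogonal to \<open>x\<close>. By Pythagoras that component is
  no longer than \<open>y\<close>.\<close>

lemma cauchy_schwarz: "cmod (cinner x y) \<le> norm x * norm y" for x :: "'h :: complex_hilbert_space"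
proof (cases "x = 0")
  case False
  then have nx: "complex_of_real (norm x) \<noteq> 0" by simp
  define c where "c = cinner x y / complex_of_real ((norm x)\<^sup>2)"
  have "cinner (c *\<^sub>C x) (y - c *\<^sub>C x) = 0"
    using nx by (simp add: c_def cinner_scaleC_left cinner_diff_right cinner_scaleC_right
        cinner_self[of x])
  from power2_norm_add_orthogonal[OF this]
  have "(norm (c *\<^sub>C x))\<^sup>2 \<le> (norm y)\<^sup>2" by simp
  then have "norm (c *\<^sub>C x) \<le> norm y" by (simp add: power2_le_iff_abs_le)
  moreover have "norm (c *\<^sub>C x) = cmod (cinner x y) / norm x"
    using nx by (simp add: norm_scaleC c_def norm_divide norm_mult power2_eq_square)
  ultimately show ?thesis using False by (simp add: field_simps)
qed simp

lemma bounded_linear_cinner_right: "bounded_linear (cinner x)" for x :: "'h :: complex_hilbert_space"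
proof (rule bounded_linear_intro[where K = "norm x"])
  show "cinner x (r *\<^sub>R y) = r *\<^sub>R cinner x y" for r y
    by (simp add: scaleC_of_real[symmetric] cinner_scaleC_right scaleR_conv_of_real)
  show "cmod (cinner x y) \<le> norm y * norm x" for y
    using cauchy_schwarz[of x y] by (simp add: mult.commute)
qed (rule cinner_add_right)

lemma closed_orthogonal: "closed {y. cinner x y = 0}" for x :: "'h :: complex_hilbert_space"
proof -
  have "continuous_on UNIV (cinner x)"
    using linear_continuous_on[OF bounded_linear_cinner_right] .
  then show ?thesis by (rule closed_Collect_eq) (rule continuous_on_const)
qed

subsection \<open>Orthonormal bases\<close>

text \<open>This is \<open>is_onb\<close> without density of the span. It is the property to which
  Zorn's lemma is applied, and Bessel's inequality and summability hold at this generality.\<close>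

definition orthonormal :: "'h :: complex_hilbert_space set \<Rightarrow> bool" where
  "orthonormal B \<longleftrightarrow> (\<forall>e\<in>B. norm e = 1) \<and> (\<forall>e\<in>B. \<forall>f\<in>B. e \<noteq> f \<longrightarrow> cinner e f = 0)"

lemma is_onb_iff: "is_onb B \<longleftrightarrow> orthonormal B \<and> closure (complex_vector.span B) = UNIV"
  by (auto simp: is_onb_def orthonormal_def)

lemma orthonormal_cinner:
  "orthonormal B \<Longrightarrow> e \<in> B \<Longrightarrow> f \<in> B \<Longrightarrow> cinner e f = (if e = f then 1 else 0)"
  by (auto simp: orthonormal_def cinner_self)

lemma orthonormal_power2_norm_sum:
  assumes "orthonormal B" "finite F" "F \<subseteq> B"
  shows "(norm (\<Sum>e\<in>F. c e *\<^sub>C e))\<^sup>2 = (\<Sum>e\<in>F. (cmod (c e))\<^sup>2)"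
proof -
  have "(norm (\<Sum>e\<in>F. c e *\<^sub>C e))\<^sup>2 = (\<Sum>e\<in>F. (norm (c e *\<^sub>C e))\<^sup>2)"
    using assms by (intro power2_norm_sum_orthogonal)
      (auto simp: orthonormal_def cinner_scaleC_left cinner_scaleC_right)
  also have "\<dots> = (\<Sum>e\<in>F. (cmod (c e))\<^sup>2)"
    using assms by (intro sum.cong) (auto simp: orthonormal_def norm_scaleC)
  finally show ?thesis .
qed

text \<open>The vector \<open>y\<close> is the orthogonal projection of \<open>x\<close> onto the
  span of \<open>F\<close>, so Pythagoras gives \<open>norm y \<le> norm x\<close>.\<close>

lemma bessel_inequality:
  fixes x :: "'h :: complex_hilbert_space"
  assumes "orthonormal B" "finite F" "F \<subseteq> B"
  shows "(\<Sum>e\<in>F. (cmod (cinner e x))\<^sup>2) \<le> (norm x)\<^sup>2"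
proof -
  define y where "y = (\<Sum>e\<in>F. cinner e x *\<^sub>C e)"
  have "cinner e (x - y) = 0" if "e \<in> F" for e
  proof -
    have "cinner e y = (\<Sum>f\<in>F. if f = e then cinner e x else 0)"
      unfolding y_def cinner_sum_right cinner_scaleC_right
      using that assms(3)
      by (intro sum.cong) (auto simp: orthonormal_cinner[OF assms(1) subsetD[OF assms(3)] subsetD[OF assms(3)]])
    then show ?thesis using that assms(2) by (simp add: cinner_diff_right)
  qed
  then have "cinner y (x - y) = 0"
    by (simp add: y_def cinner_sum_left cinner_scaleC_left)
  from power2_norm_add_orthogonal[OF this]
  have "(norm y)\<^sup>2 \<le> (norm x)\<^sup>2" by simp
  then show ?thesis
    using orthonormal_power2_norm_sum[OF assms] by (simp add: y_def)
qed

text \<open>Bessel bounds the finite sums of squared coefficients, so they have a supremum. Beyond a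
  finite set that nearly attains it the partial sums hardly move; they form a Cauchy net, which
  converges by completeness. \<open>B\<close> may be uncountable.\<close>

lemma orthonormal_summable_on:
  fixes x :: "'h :: complex_hilbert_space"
  assumes B: "orthonormal B"
  shows "(\<lambda>e. cinner e x *\<^sub>C e) summable_on B"
proof -
  define g where "g e = (cmod (cinner e x))\<^sup>2" for e
  define S where "S F = (\<Sum>e\<in>F. cinner e x *\<^sub>C e)" for F
  let ?A = "{F. F \<subseteq> B \<and> finite F}"
  have bdd: "bdd_above (sum g ` ?A)"
    using bessel_inequality[OF B] by (auto simp: g_def intro!: bdd_aboveI2)
  have "cauchy_filter (filtermap S (finite_subsets_at_top B))"
    unfolding cauchy_filter_metric_filtermap
  proof (intro allI impI)
    fix r :: real assume "r > 0"
    have "sum g ` ?A \<noteq> {}" by auto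
    \<comment> \<open>The gap is \<open>(r / 2)\<^sup>2\<close> because \<open>g\<close> adds
      squared norms: each finite \<open>F\<close> in \<open>B\<close> containing \<open>F0\<close>
      has \<open>S F\<close> within \<open>r / 2\<close> of \<open>S F0\<close>, hence two such sums
      are within \<open>r\<close> of each other.\<close>
    moreover have "Sup (sum g ` ?A) - (r / 2)\<^sup>2 < Sup (sum g ` ?A)" using \<open>r > 0\<close> by simp
    ultimately have "\<exists>s\<in>sum g ` ?A. Sup (sum g ` ?A) - (r / 2)\<^sup>2 < s" by (rule less_cSupD)
    then obtain F0 where F0: "F0 \<subseteq> B" "finite F0" "Sup (sum g ` ?A) - (r / 2)\<^sup>2 < sum g F0"
      by auto
    have close: "dist (S F) (S F0) < r / 2" if F: "finite F" "F0 \<subseteq> F" "F \<subseteq> B" for F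
    proof -
      have "(norm (S F - S F0))\<^sup>2 = sum g F - sum g F0"
        using orthonormal_power2_norm_sum[OF B, of "F - F0" "\<lambda>e. cinner e x"] F
        by (auto simp: S_def g_def sum_diff)
      also have "\<dots> < (r / 2)\<^sup>2"
        using F0 F cSup_upper[OF _ bdd, of "sum g F"] by auto
      finally show ?thesis
        using \<open>r > 0\<close> power2_less_imp_less[of "norm (S F - S F0)" "r / 2"] by (simp add: dist_norm)
    qed
    show "\<exists>P. eventually P (finite_subsets_at_top B) \<and> (\<forall>F G. P F \<and> P G \<longrightarrow> dist (S F) (S G) < r)"
    proof (intro exI conjI allI impI)
      show "\<forall>\<^sub>F F in finite_subsets_at_top B. finite F \<and> F0 \<subseteq> F \<and> F \<subseteq> B"
        unfolding eventually_finite_subsets_at_top using F0 by blast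
      fix F G assume "(finite F \<and> F0 \<subseteq> F \<and> F \<subseteq> B) \<and> (finite G \<and> F0 \<subseteq> G \<and> G \<subseteq> B)"
      then show "dist (S F) (S G) < r"
        using close[of F] close[of G] dist_triangle2[of "S F" "S G" "S F0"] by auto
    qed
  qed
  moreover have "complete (UNIV :: 'h set)"
    by (meson Cauchy_convergent UNIV_I complete_def convergent_def)
  ultimately obtain y where "(S \<longlongrightarrow> y) (finite_subsets_at_top B)"
    using cauchy_filter_complete_converges[of "filtermap S (finite_subsets_at_top B)" UNIV]
    by (auto simp: filterlim_def filtermap_bot_iff)
  then show ?thesis by (auto simp: summable_on_def has_sum_def S_def[abs_def])
qed

text \<open>Continuity lets \<open>cinner e\<close> pass through the sum, and only the term at
  \<open>e\<close> survives. This serves both the expansion in a basis and the construction of a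
  basis.\<close>

lemma orthonormal_residual:
  fixes x :: "'h :: complex_hilbert_space"
  assumes B: "orthonormal B" and y: "((\<lambda>e. cinner e x *\<^sub>C e) has_sum y) B" and e: "e \<in> B"
  shows "cinner e (x - y) = 0"
proof -
  have "((\<lambda>f. cinner e (cinner f x *\<^sub>C f)) has_sum cinner e y) B"
    by (rule has_sum_bounded_linear[OF bounded_linear_cinner_right y])
  moreover have "((\<lambda>f. cinner e (cinner f x *\<^sub>C f)) has_sum cinner e x) B"
    using e orthonormal_cinner[OF B e]
    by (intro has_sum_finite_neutralI[of "{e}"]) (auto simp: cinner_scaleC_right)
  ultimately have "cinner e y = cinner e x" by (rule infsumI[symmetric, THEN trans, OF _ infsumI])
  then show ?thesis by (simp add: cinner_diff_right)
qed

text \<open>The residual \<open>x - y\<close> is orthogonal to \<open>B\<close>, hence to the closed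
  span of \<open>B\<close>, which is the whole space. So it is orthogonal to itself and
  vanishes.\<close>

lemma onb_expansion:
  fixes x :: "'h :: complex_hilbert_space"
  assumes "is_onb B"
  shows "((\<lambda>e. cinner e x *\<^sub>C e) has_sum x) B"
proof -
  have B: "orthonormal B" and dense: "closure (complex_vector.span B) = UNIV"
    using assms by (auto simp: is_onb_iff)
  from orthonormal_summable_on[OF B] obtain y where y: "((\<lambda>e. cinner e x *\<^sub>C e) has_sum y) B"
    by (auto simp: summable_on_def)
  have "complex_vector.subspace {z. cinner (x - y) z = 0}"
    by (simp add: complex_vector.subspace_def cinner_add_right cinner_scaleC_right)
  moreover have "B \<subseteq> {z. cinner (x - y) z = 0}"
    using orthonormal_residual[OF B y] cinner_eq_0_commute by blast
  ultimately have "complex_vector.span B \<subseteq> {z. cinner (x - y) z = 0}"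
    by (rule complex_vector.span_minimal[rotated])
  then have "closure (complex_vector.span B) \<subseteq> {z. cinner (x - y) z = 0}"
    by (rule closure_minimal) (rule closed_orthogonal)
  then have "cinner (x - y) (x - y) = 0" unfolding dense by blast
  then have "x = y" by (simp add: cinner_self)
  with y show ?thesis by simp
qed

text \<open>Zorn's lemma yields a maximal orthonormal set. If some \<open>x\<close> differed from
  the sum of its expansion, the normalized residual could be adjoined. Existence is also what gives
  meaning to the basis chosen in \<open>op_trace\<close>.\<close>

lemma exists_onb: "\<exists>B :: 'h :: complex_hilbert_space set. is_onb B"
proof -
  have "\<exists>B\<in>Collect (orthonormal :: 'h set \<Rightarrow> bool). \<forall>X\<in>Collect orthonormal. B \<subseteq> X \<longrightarrow> X = B"
  proof (rule subset_Zorn')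
    fix C :: "'h set set" assume "subset.chain (Collect orthonormal) C"
    then have C: "C \<subseteq> Collect orthonormal" "\<And>X Y. X \<in> C \<Longrightarrow> Y \<in> C \<Longrightarrow> X \<subseteq> Y \<or> Y \<subseteq> X"
      by (auto simp: subset_chain_def)
    show "\<Union>C \<in> Collect orthonormal"
      unfolding orthonormal_def mem_Collect_eq
    proof (intro conjI ballI impI)
      fix e f assume "e \<in> \<Union>C" "f \<in> \<Union>C" "e \<noteq> f"
      \<comment> \<open>In a chain, two members of the union already lie in one common set.\<close>
      then obtain X where "X \<in> C" "e \<in> X" "f \<in> X" using C(2) by blast
      then show "cinner e f = 0" using C(1) \<open>e \<noteq> f\<close> by (auto simp: orthonormal_def)
    qed (use C(1) in \<open>auto simp: orthonormal_def\<close>)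
  qed
  then obtain B :: "'h set" where B: "orthonormal B"
    and max: "\<And>X. orthonormal X \<Longrightarrow> B \<subseteq> X \<Longrightarrow> X = B" by blast
  have "x \<in> closure (complex_vector.span B)" for x
  proof -
    from orthonormal_summable_on[OF B] obtain y where y: "((\<lambda>e. cinner e x *\<^sub>C e) has_sum y) B"
      by (auto simp: summable_on_def)
    have "x = y"
    proof (rule ccontr)
      assume "x \<noteq> y"
      define u where "u = (1 / norm (x - y)) *\<^sub>C (x - y)"
      have u: "norm u = 1" using \<open>x \<noteq> y\<close> by (simp add: u_def norm_scaleC norm_divide)
      have orth: "cinner e u = 0" if "e \<in> B" for e
        using orthonormal_residual[OF B y that] by (simp add: u_def cinner_scaleC_right)
      then have "cinner u e = 0" if "e \<in> B" for e
        using that cinner_eq_0_commute by blast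
      with orth have "orthonormal (insert u B)"
        using B u by (auto simp: orthonormal_def)
      with max have "u \<in> B" by blast
      with orth u show False by (force simp: cinner_self)
    qed
    moreover have "y \<in> closure (complex_vector.span B)"
    proof (rule Lim_in_closed_set[OF closed_closure _ _ y[unfolded has_sum_def]])
      show "\<forall>\<^sub>F F in finite_subsets_at_top B.
              (\<Sum>e\<in>F. cinner e x *\<^sub>C e) \<in> closure (complex_vector.span B)"
      proof (rule eventually_finite_subsets_at_top_weakI)
        fix F assume "finite F" "F \<subseteq> B"
        then have "(\<Sum>e\<in>F. cinner e x *\<^sub>C e) \<in> complex_vector.span B"
          by (intro complex_vector.span_sum complex_vector.span_scale complex_vector.span_base) auto
        then show "(\<Sum>e\<in>F. cinner e x *\<^sub>C e) \<in> closure (complex_vector.span B)"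
          using closure_subset by blast
      qed
    qed simp
    ultimately show ?thesis by simp
  qed
  with B show ?thesis by (auto simp: is_onb_iff)
qed

section \<open>Parseval's identity and the trace of rank-one operators\<close>

lemma onb_parseval:
  fixes v w :: "'h :: complex_hilbert_space"
  assumes "is_onb B"
  shows "((\<lambda>e. cinner e v * cinner w e) has_sum cinner w v) B"
  using has_sum_bounded_linear[OF bounded_linear_cinner_right onb_expansion[OF assms]]
  by (simp add: cinner_scaleC_right)

text \<open>The diagonal sum is a Parseval series, so its value is the same in every orthonormal
  basis; the choice hidden in \<open>op_trace\<close> is therefore harmless.\<close>

lemma rank_one_has_trace:
  assumes "is_onb B" "\<And>x. blinfun_apply T x = cinner w x *\<^sub>C v"
  shows "((\<lambda>e. cinner e (blinfun_apply T e)) has_sum cinner w v) B"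
  using onb_parseval[OF assms(1), of v w] by (simp add: assms(2) cinner_scaleC_right mult.commute)

lemma op_trace_rank_one:
  fixes T :: "'h :: complex_hilbert_space \<Rightarrow>\<^sub>L 'h"
  assumes "\<And>x. blinfun_apply T x = cinner w x *\<^sub>C v"
  shows "op_trace T = cinner w v"
  unfolding op_trace_def
  by (rule infsumI, rule rank_one_has_trace) (use exists_onb in \<open>auto intro: someI_ex assms\<close>)

subsection \<open>Projections onto rays\<close>

text \<open>Dividing by the squared norm allows unnormalized vectors, so that rays can later be
  given by integer coordinates. For \<open>v = 0\<close> the operator is \<open>0\<close>.\<close>

definition ray_proj :: "'h :: complex_hilbert_space \<Rightarrow> 'h \<Rightarrow>\<^sub>L 'h" where
  "ray_proj v = Blinfun (\<lambda>x. (cinner v x / complex_of_real ((norm v)\<^sup>2)) *\<^sub>C v)"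

lemma ray_proj_apply:
  "blinfun_apply (ray_proj v) x = (cinner v x / complex_of_real ((norm v)\<^sup>2)) *\<^sub>C v"
proof -
  have "bounded_linear (\<lambda>x. (cinner v x / complex_of_real ((norm v)\<^sup>2)) *\<^sub>C v)"
  \<comment> \<open>The bound equals \<open>1\<close> for nonzero \<open>v\<close>; left
    uncancelled, it also covers \<open>v = 0\<close>.\<close>
  proof (rule bounded_linear_intro[where K = "norm v / (norm v)\<^sup>2 * norm v"])
    show "norm ((cinner v x / complex_of_real ((norm v)\<^sup>2)) *\<^sub>C v)
            \<le> norm x * (norm v / (norm v)\<^sup>2 * norm v)" for x
    proof -
      have "cmod (cinner v x) / (norm v)\<^sup>2 * norm v \<le> norm v * norm x / (norm v)\<^sup>2 * norm v"
        by (intro mult_right_mono divide_right_mono cauchy_schwarz) auto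
      then show ?thesis by (simp add: norm_scaleC norm_divide norm_power ac_simps)
    qed
    show "(cinner v (r *\<^sub>R x) / complex_of_real ((norm v)\<^sup>2)) *\<^sub>C v
            = r *\<^sub>R ((cinner v x / complex_of_real ((norm v)\<^sup>2)) *\<^sub>C v)" for r x
      by (simp add: scaleC_of_real[symmetric] cinner_scaleC_right)
  qed (simp add: cinner_add_right add_divide_distrib scaleC_add_left)
  then show ?thesis by (simp add: ray_proj_def bounded_linear_Blinfun_apply)
qed

text \<open>Moving the normalization into the inner product gives the shape that the trace lemmas
  for rank-one operators expect.\<close>

lemma ray_proj_rank_one:
  "blinfun_apply (ray_proj v) x = cinner ((1 / complex_of_real ((norm v)\<^sup>2)) *\<^sub>C v) x *\<^sub>C v"
  by (simp add: ray_proj_apply cinner_scaleC_left)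

lemma cinner_ray_proj:
  "cinner y (blinfun_apply (ray_proj v) x) = cinner v x * cinner y v / complex_of_real ((norm v)\<^sup>2)"
  by (simp add: ray_proj_apply cinner_scaleC_right)

lemma hermitian_ray_proj: "hermitian_op (ray_proj v)"
proof -
  have "cinner (blinfun_apply (ray_proj v) x) y = cinner x (blinfun_apply (ray_proj v) y)" for x y
    by (simp add: ray_proj_apply cinner_scaleC_right cinner_scaleC_left
        cinner_commute[of x v] mult.commute)
  then show ?thesis
    by (auto simp: hermitian_op_def complex_linear_def ray_proj_apply cinner_scaleC_right)
qed

lemma cinner_ray_proj_self:
  "cinner x (blinfun_apply (ray_proj v) x) = complex_of_real ((cmod (cinner v x))\<^sup>2 / (norm v)\<^sup>2)"
  by (simp add: cinner_ray_proj cinner_mult_cinner_commute)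

lemma positive_ray_proj: "positive_op (ray_proj v)"
  unfolding positive_op_def by (simp only: hermitian_ray_proj cinner_ray_proj_self Re_complex_of_real) simp

text \<open>Positivity of the complement is the Cauchy-Schwarz inequality divided by the squared
  norm of \<open>v\<close>.\<close>

lemma povm_element_ray_proj: "povm_element (ray_proj v)"
proof -
  have "hermitian_op (id_blinfun - ray_proj v)"
    using hermitian_ray_proj[of v]
    by (simp add: hermitian_op_def complex_linear_def blinfun.diff_left cinner_diff_left
        cinner_diff_right complex_vector.scale_right_diff_distrib)
  moreover have "0 \<le> Re (cinner x (blinfun_apply (id_blinfun - ray_proj v) x))" for x
  proof -
    have "(cmod (cinner v x))\<^sup>2 \<le> (norm x)\<^sup>2 * (norm v)\<^sup>2"
      using power_mono[OF cauchy_schwarz[of v x] norm_ge_zero, of 2]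
      by (simp add: power_mult_distrib mult.commute)
    then have "(cmod (cinner v x))\<^sup>2 / (norm v)\<^sup>2 \<le> (norm x)\<^sup>2"
      by (cases "v = 0") (simp_all add: divide_le_eq)
    then show ?thesis
      by (simp only: blinfun.diff_left cinner_diff_right cinner_ray_proj_self) (simp add: cinner_self)
  qed
  ultimately have "positive_op (id_blinfun - ray_proj v)" by (simp add: positive_op_def)
  then show ?thesis by (simp add: povm_element_def positive_ray_proj)
qed

text \<open>A positive operator is its own modulus, so the convergent diagonal sum of the projection
  itself witnesses trace class.\<close>

lemma density_ray_proj:
  assumes "v \<noteq> 0"
  shows "density_op (ray_proj v)"
proof -
  have "is_modulus (ray_proj v) (ray_proj v)"
    by (simp add: is_modulus_def positive_ray_proj)
  moreover obtain B :: "'a set" where "is_onb B" using exists_onb by blast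
  moreover from this have "(\<lambda>e. cinner e (blinfun_apply (ray_proj v) e)) summable_on B"
    using rank_one_has_trace[OF _ ray_proj_rank_one] by (auto simp: summable_on_def)
  ultimately have "trace_class (ray_proj v)"
    using hermitian_ray_proj[of v] unfolding trace_class_def hermitian_op_def by blast
  moreover have "op_trace (ray_proj v) = 1"
    using assms by (simp add: op_trace_rank_one[OF ray_proj_rank_one] cinner_scaleC_left cinner_self)
  ultimately show ?thesis by (simp add: density_op_def positive_ray_proj)
qed

text \<open>The composite is again of rank one: it sends \<open>x\<close> to
  \<open>(c * cinner w x) *\<^sub>C v\<close>. The factor enters the first slot of the inner product
  as \<open>cnj c\<close> because that slot is antilinear.\<close>

lemma op_trace_ray_proj_compose:
  "op_trace (ray_proj v o\<^sub>L ray_proj w)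
     = complex_of_real ((cmod (cinner v w))\<^sup>2 / ((norm v)\<^sup>2 * (norm w)\<^sup>2))"
proof -
  define c where "c = cinner v w / complex_of_real ((norm v)\<^sup>2 * (norm w)\<^sup>2)"
  have "op_trace (ray_proj v o\<^sub>L ray_proj w) = cinner (cnj c *\<^sub>C w) v"
    by (rule op_trace_rank_one)
      (simp add: c_def ray_proj_apply cinner_scaleC_right cinner_scaleC_left ac_simps)
  also have "\<dots> = c * cinner w v" by (simp add: cinner_scaleC_left)
  finally show ?thesis by (simp add: c_def cinner_mult_cinner_commute)
qed

text \<open>The dimension hypothesis, in either of its two cases, prevents a single vector from
  spanning the space. One Gram-Schmidt step applied to a vector outside \<open>span {e}\<close> then
  gives \<open>f\<close>.\<close>

lemma ex_orthonormal_pair: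
  assumes dim: "cdim_at_least 2 TYPE('h :: complex_hilbert_space)"
  obtains e f :: "'h :: complex_hilbert_space" where "norm e = 1" "norm f = 1" "cinner e f = 0"
proof -
  have ns: "complex_vector.span {x} \<noteq> UNIV" for x :: 'h
  proof
    assume sp: "complex_vector.span {x} = UNIV"
    then have "complex_vector.dim (UNIV :: 'h set) \<le> card {x}"
      by (intro complex_vector.dim_le_card) auto
    with sp dim show False by (auto simp: cdim_at_least_def)
  qed
  have unit: "norm ((1 / complex_of_real (norm x)) *\<^sub>C x) = 1" if "x \<noteq> 0" for x :: 'h
    using that by (simp add: norm_scaleC norm_divide)
  from ns[of 0] obtain x :: 'h where "x \<noteq> 0"
    using complex_vector.span_zero by (metis (full_types) UNIV_eq_I)
  define e where "e = (1 / complex_of_real (norm x)) *\<^sub>C x"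
  have e: "norm e = 1" using unit \<open>x \<noteq> 0\<close> by (simp add: e_def)
  from ns[of e] obtain y where y: "y \<notin> complex_vector.span {e}" by blast
  define z where "z = y - cinner e y *\<^sub>C e"
  have mem: "cinner e y *\<^sub>C e \<in> complex_vector.span {e}"
    by (intro complex_vector.span_scale complex_vector.span_base) simp
  have "y \<noteq> cinner e y *\<^sub>C e"
  proof
    assume "y = cinner e y *\<^sub>C e"
    with mem have "y \<in> complex_vector.span {e}" by (rule back_subst[OF _ sym])
    with y show False by contradiction
  qed
  then have "z \<noteq> 0" unfolding z_def right_minus_eq .
  moreover have "cinner e z = 0"
    using e by (simp add: z_def cinner_diff_right cinner_scaleC_right cinner_self)
  ultimately show ?thesis
    using that[OF e unit[of z]] by (simp add: cinner_scaleC_right)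
qed

subsection \<open>Mixtures of two pure states\<close>

lemma cinner_scaleR_right: "cinner x (r *\<^sub>R y) = complex_of_real r * cinner x y"
  for x :: "'h :: complex_hilbert_space"
  by (simp add: scaleC_of_real[symmetric] cinner_scaleC_right)

lemma cinner_scaleR_left: "cinner (r *\<^sub>R x) y = complex_of_real r * cinner x y"
  for x :: "'h :: complex_hilbert_space"
  by (simp add: scaleC_of_real[symmetric] cinner_scaleC_left)

lemma scaleR_scaleC_commute: "r *\<^sub>R (c *\<^sub>C x) = c *\<^sub>C (r *\<^sub>R x)"
  for x :: "'h :: complex_hilbert_space"
  by (simp only: scaleC_of_real[symmetric] scaleC_scaleC mult.commute)

text \<open>Convex-linearity speaks only about mixtures that are density operators. The diagonal
  sums of the two projections are \<open>1\<close> in every basis, so the mixture has trace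
  \<open>a + (1 - a)\<close>.\<close>

lemma density_mixture:
  fixes v w :: "'h :: complex_hilbert_space"
  assumes "v \<noteq> 0" "w \<noteq> 0" "0 \<le> a" "a \<le> 1"
  shows "density_op (a *\<^sub>R ray_proj v + (1 - a) *\<^sub>R ray_proj w)" (is "density_op ?T")
proof -
  have apply_T: "blinfun_apply ?T x
      = a *\<^sub>R blinfun_apply (ray_proj v) x + (1 - a) *\<^sub>R blinfun_apply (ray_proj w) x" for x
    by (simp add: blinfun.add_left blinfun.scaleR_left)
  have "complex_linear ?T"
    using hermitian_ray_proj[of v] hermitian_ray_proj[of w]
    by (simp add: hermitian_op_def complex_linear_def apply_T scaleC_add_right scaleR_scaleC_commute)
  then have herm: "hermitian_op ?T"
    using hermitian_ray_proj[of v] hermitian_ray_proj[of w]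
    by (simp add: hermitian_op_def apply_T cinner_add_left cinner_add_right
        cinner_scaleR_left cinner_scaleR_right)
  have pos: "positive_op ?T"
    using positive_ray_proj[of v] positive_ray_proj[of w] assms herm
    by (simp add: positive_op_def apply_T cinner_add_right cinner_scaleR_right)
  have trace: "((\<lambda>e. cinner e (blinfun_apply ?T e)) has_sum 1) B" if B: "is_onb B" for B
  proof -
    have one: "((\<lambda>e. cinner e (blinfun_apply (ray_proj u) e)) has_sum 1) B" if "u \<noteq> 0" for u :: 'h
      using rank_one_has_trace[OF B ray_proj_rank_one, of u] that
      by (simp add: cinner_scaleC_left cinner_self)
    have "((\<lambda>e. complex_of_real a * cinner e (blinfun_apply (ray_proj v) e)
        + complex_of_real (1 - a) * cinner e (blinfun_apply (ray_proj w) e))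
      has_sum (complex_of_real a * 1 + complex_of_real (1 - a) * 1)) B"
      by (intro has_sum_add has_sum_cmult_right one assms)
    then show ?thesis by (simp add: apply_T cinner_add_right cinner_scaleR_right)
  qed
  obtain B :: "'h set" where "is_onb B" using exists_onb by blast
  then have "trace_class ?T"
    using trace herm pos unfolding trace_class_def hermitian_op_def is_modulus_def summable_on_def
    by blast
  moreover have "op_trace ?T = 1"
    unfolding op_trace_def by (rule infsumI, rule trace) (use exists_onb in \<open>auto intro: someI_ex\<close>)
  ultimately show ?thesis by (simp add: density_op_def pos)
qed

text \<open>These are the matrix entries of the projection in the basis \<open>e\<close>,
  \<open>f\<close>. Since \<open>a\<close> and \<open>b\<close> are real, both off-diagonal entries
  agree, and three real coefficients describe the operator.\<close>

lemma ray_proj_real_comb: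
  fixes e f :: "'h :: complex_hilbert_space" and a b :: real
  assumes "norm e = 1" "norm f = 1" "cinner e f = 0"
  shows "blinfun_apply (ray_proj (a *\<^sub>R e + b *\<^sub>R f)) x =
    (a\<^sup>2 / (a\<^sup>2 + b\<^sup>2)) *\<^sub>R (cinner e x *\<^sub>C e) + (a * b / (a\<^sup>2 + b\<^sup>2)) *\<^sub>R (cinner f x *\<^sub>C e + cinner e x *\<^sub>C f)
    + (b\<^sup>2 / (a\<^sup>2 + b\<^sup>2)) *\<^sub>R (cinner f x *\<^sub>C f)"
proof -
  have norm: "(norm (a *\<^sub>R e + b *\<^sub>R f))\<^sup>2 = a\<^sup>2 + b\<^sup>2"
    using assms by (subst power2_norm_add_orthogonal)
      (simp_all add: cinner_scaleR_left cinner_scaleR_right)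
  define p q n where "p = cinner e x" and "q = cinner f x" and "n = complex_of_real (a\<^sup>2 + b\<^sup>2)"
  define A B where "A = complex_of_real a" and "B = complex_of_real b"
  have "blinfun_apply (ray_proj (a *\<^sub>R e + b *\<^sub>R f)) x = ((A * p + B * q) / n) *\<^sub>C (A *\<^sub>C e + B *\<^sub>C f)"
    unfolding ray_proj_apply norm p_def q_def n_def A_def B_def
    by (simp only: cinner_add_left cinner_scaleR_left scaleC_of_real)
  also have "\<dots> = (A * A / n * p + A * B / n * q) *\<^sub>C e + (A * B / n * p + B * B / n * q) *\<^sub>C f"
    unfolding scaleC_add_right scaleC_scaleC
    by (intro arg_cong2[where f = "(+)"] arg_cong2[where f = scaleC] refl)
      (simp_all add: add_divide_distrib algebra_simps)
  also have "\<dots> = (A * A / n) *\<^sub>C (p *\<^sub>C e) + (A * B / n) *\<^sub>C (q *\<^sub>C e + p *\<^sub>C f) + (B * B / n) *\<^sub>C (q *\<^sub>C f)"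
    by (simp only: scaleC_add_left scaleC_add_right scaleC_scaleC add.assoc)
  finally show ?thesis
    unfolding p_def q_def n_def A_def B_def
    by (simp only: scaleC_of_real of_real_mult[symmetric] of_real_divide[symmetric] power2_eq_square)
qed

text \<open>Reduces an identity between mixtures of real rays in one plane to the comparison of
  three matrix entries.\<close>

lemma ray_proj_mixture_eqI:
  fixes e f :: "'h :: complex_hilbert_space" and r s a b c d r' s' a' b' c' d' :: real
  assumes ef: "norm e = 1" "norm f = 1" "cinner e f = 0"
    and "r * (a\<^sup>2 / (a\<^sup>2 + b\<^sup>2)) + s * (c\<^sup>2 / (c\<^sup>2 + d\<^sup>2)) = r' * (a'\<^sup>2 / (a'\<^sup>2 + b'\<^sup>2)) + s' * (c'\<^sup>2 / (c'\<^sup>2 + d'\<^sup>2))"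
    and "r * (a * b / (a\<^sup>2 + b\<^sup>2)) + s * (c * d / (c\<^sup>2 + d\<^sup>2)) = r' * (a' * b' / (a'\<^sup>2 + b'\<^sup>2)) + s' * (c' * d' / (c'\<^sup>2 + d'\<^sup>2))"
    and "r * (b\<^sup>2 / (a\<^sup>2 + b\<^sup>2)) + s * (d\<^sup>2 / (c\<^sup>2 + d\<^sup>2)) = r' * (b'\<^sup>2 / (a'\<^sup>2 + b'\<^sup>2)) + s' * (d'\<^sup>2 / (c'\<^sup>2 + d'\<^sup>2))"
  shows "r *\<^sub>R ray_proj (a *\<^sub>R e + b *\<^sub>R f) + s *\<^sub>R ray_proj (c *\<^sub>R e + d *\<^sub>R f)
    = r' *\<^sub>R ray_proj (a' *\<^sub>R e + b' *\<^sub>R f) + s' *\<^sub>R ray_proj (c' *\<^sub>R e + d' *\<^sub>R f)"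
proof (rule blinfun_eqI)
  fix x
  have collect: "r *\<^sub>R (p *\<^sub>R U + q *\<^sub>R V + t *\<^sub>R W) + s *\<^sub>R (p' *\<^sub>R U + q' *\<^sub>R V + t' *\<^sub>R W)
      = (r * p + s * p') *\<^sub>R U + (r * q + s * q') *\<^sub>R V + (r * t + s * t') *\<^sub>R W"
    for r s p q t p' q' t' :: real and U V W :: 'h
    by (simp only: scaleR_add_right scaleR_add_left scaleR_scaleR add_ac)
  show "blinfun_apply (r *\<^sub>R ray_proj (a *\<^sub>R e + b *\<^sub>R f) + s *\<^sub>R ray_proj (c *\<^sub>R e + d *\<^sub>R f)) x
    = blinfun_apply (r' *\<^sub>R ray_proj (a' *\<^sub>R e + b' *\<^sub>R f) + s' *\<^sub>R ray_proj (c' *\<^sub>R e + d' *\<^sub>R f)) x"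
    unfolding blinfun.add_left blinfun.scaleR_left ray_proj_real_comb[OF ef] collect assms(4-6) ..
qed

subsection \<open>Nonnegative representations\<close>

text \<open>The two-outcome POVM formed by \<open>E\<close> and its complement has response
  functions that are nonnegative and add up to \<open>1\<close>.\<close>

lemma response_le_1:
  assumes qpr: "quasiprobability_representation M \<mu> \<xi>" and nn: "nonnegative_representation M \<mu> \<xi>"
    and E: "povm_element E" and l: "l \<in> space M"
  shows "\<xi> E l \<le> 1"
proof -
  have "povm_element (id_blinfun - E)" using E by (simp add: povm_element_def)
  then have "0 \<le> \<xi> (id_blinfun - E) l" using nn l by (auto simp: nonnegative_representation_def)
  moreover have "povm {0, 1} (\<lambda>k. if k = 0 then E else id_blinfun - E)"
    using E by (simp add: povm_def povm_element_def)
  then have "(\<Sum>k\<in>{0, 1 :: nat}. \<xi> (if k = 0 then E else id_blinfun - E) l) = 1"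
    using qpr l unfolding quasiprobability_representation_def by blast
  ultimately show ?thesis by simp
qed

text \<open>The outcome \<open>ray_proj v\<close> has probability \<open>1\<close> in the state
  along \<open>v\<close> and \<open>0\<close> in the state along \<open>w\<close>. Each value is
  extremal, so the integrals force pointwise equalities almost everywhere.\<close>

lemma orthogonal_states_disjoint:
  assumes qpr: "quasiprobability_representation M \<mu> \<xi>" and nn: "nonnegative_representation M \<mu> \<xi>"
    and vw: "v \<noteq> 0" "w \<noteq> 0" "cinner w v = 0"
  shows "AE l in M. \<mu> (ray_proj v) l * \<mu> (ray_proj w) l = 0"
proof -
  let ?E = "ray_proj v"
  have E: "povm_element ?E" by (rule povm_element_ray_proj)
  have dens: "density_op (ray_proj v)" "density_op (ray_proj w)"
    using vw by (auto intro: density_ray_proj)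
  have int: "integrable M (\<mu> \<rho>)" "(\<integral>l. \<mu> \<rho> l \<partial>M) = 1"
    "integrable M (\<lambda>l. \<mu> \<rho> l * \<xi> ?E l)"
    "op_trace (\<rho> o\<^sub>L ?E) = complex_of_real (\<integral>l. \<mu> \<rho> l * \<xi> ?E l \<partial>M)" if "density_op \<rho>" for \<rho>
    using qpr that E unfolding quasiprobability_representation_def by blast+
  have nonneg: "0 \<le> \<mu> \<rho> l" "0 \<le> \<xi> ?E l" if "density_op \<rho>" "l \<in> space M" for \<rho> l
    using nn that E unfolding nonnegative_representation_def by blast+
  have "(\<integral>l. \<mu> (ray_proj v) l * \<xi> ?E l \<partial>M) = 1"
    using int(4)[OF dens(1)] vw
    by (simp only: op_trace_ray_proj_compose of_real_eq_iff)
      (simp add: norm_power cinner_self power2_eq_square norm_mult)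
  then have "(\<integral>l. \<mu> (ray_proj v) l - \<mu> (ray_proj v) l * \<xi> ?E l \<partial>M) = 0"
    using int(1-3)[OF dens(1)] by simp
  moreover have "\<mu> (ray_proj v) l * \<xi> ?E l \<le> \<mu> (ray_proj v) l" if "l \<in> space M" for l
    using mult_left_mono[OF response_le_1[OF qpr nn E that] nonneg(1)[OF dens(1) that]] by simp
  ultimately have one: "AE l in M. \<mu> (ray_proj v) l - \<mu> (ray_proj v) l * \<xi> ?E l = 0"
    using int(1,3)[OF dens(1)]
    by (subst (asm) integral_nonneg_eq_0_iff_AE) auto
  have "(\<integral>l. \<mu> (ray_proj w) l * \<xi> ?E l \<partial>M) = 0"
    using int(4)[OF dens(2)] vw
    by (simp only: op_trace_ray_proj_compose of_real_eq_iff) simp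
  then have zero: "AE l in M. \<mu> (ray_proj w) l * \<xi> ?E l = 0"
    using int(3)[OF dens(2)] nonneg dens
    by (subst (asm) integral_nonneg_eq_0_iff_AE) auto
  \<comment> \<open>At almost every point either \<open>\<mu> (ray_proj v)\<close> vanishes or the
    response is \<open>1\<close>, and in the second case \<open>zero\<close> makes
    \<open>\<mu> (ray_proj w)\<close> vanish.\<close>
  from one zero show ?thesis by eventually_elim auto
qed

lemma convex_linear_mixture:
  assumes "convex_linear_representation M \<mu> \<xi>" "v \<noteq> 0" "w \<noteq> 0" "0 \<le> a" "a \<le> 1" "l \<in> space M"
  shows "\<mu> (a *\<^sub>R ray_proj v + (1 - a) *\<^sub>R ray_proj w) l
    = a * \<mu> (ray_proj v) l + (1 - a) * \<mu> (ray_proj w) l"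
proof -
  let ?w = "\<lambda>j :: nat. if j = 0 then a else 1 - a"
  let ?\<rho> = "\<lambda>j :: nat. if j = 0 then ray_proj v else ray_proj w"
  have "\<forall>\<rho> \<rho>s. density_op \<rho> \<longrightarrow> (\<forall>j\<in>{0, 1}. density_op (\<rho>s j)) \<longrightarrow>
     \<rho> = (\<Sum>j\<in>{0, 1}. ?w j *\<^sub>R \<rho>s j) \<longrightarrow> (\<forall>l\<in>space M. \<mu> \<rho> l = (\<Sum>j\<in>{0, 1}. ?w j * \<mu> (\<rho>s j) l))"
    using assms(1)[unfolded convex_linear_representation_def, rule_format, of "{0, 1}" ?w] assms(4,5)
    by simp
  from this[rule_format, OF density_mixture[OF assms(2-5)], of ?\<rho> l] show ?thesis
    using assms by (simp add: density_ray_proj)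
qed

section \<open>The contradiction within a real plane\<close>

theorem theorem2:
  fixes M :: "'l measure"
  assumes "cdim_at_least 2 TYPE('h :: complex_hilbert_space)"
  shows "\<not> (\<exists>(\<mu> :: ('h \<Rightarrow>\<^sub>L 'h) \<Rightarrow> 'l \<Rightarrow> real) (\<xi> :: ('h \<Rightarrow>\<^sub>L 'h) \<Rightarrow> 'l \<Rightarrow> real).
            quasiprobability_representation M \<mu> \<xi> \<and>
            nonnegative_representation M \<mu> \<xi> \<and>
            convex_linear_representation M \<mu> \<xi>)"
proof (rule notI, elim exE conjE)
  fix \<mu> \<xi> :: "('h \<Rightarrow>\<^sub>L 'h) \<Rightarrow> 'l \<Rightarrow> real"
  assume qpr: "quasiprobability_representation M \<mu> \<xi>"
    and nn: "nonnegative_representation M \<mu> \<xi>"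
    and cl: "convex_linear_representation M \<mu> \<xi>"
  obtain e f :: 'h where ef: "norm e = 1" "norm f = 1" "cinner e f = 0"
    using ex_orthonormal_pair[OF assms] by blast
  then have fe: "cinner f e = 0" by (simp add: cinner_eq_0_commute)
  define ket where "ket a b = a *\<^sub>R e + b *\<^sub>R f" for a b :: real
  have ket_cinner: "cinner (ket a b) (ket c d) = complex_of_real (a * c + b * d)" for a b c d
    using ef fe by (simp add: ket_def cinner_add_left cinner_add_right cinner_scaleR_left
        cinner_scaleR_right cinner_self)
  have ket_nonzero: "ket a b \<noteq> 0" if "a \<noteq> 0 \<or> b \<noteq> 0" for a b
    using ket_cinner[of a b a b] that by (auto simp del: of_real_add)
  define m where "m a b = \<mu> (ray_proj (ket a b))" for a b
  note mix = convex_linear_mixture[OF cl ket_nonzero ket_nonzero, folded m_def]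
  \<comment> \<open>\<open>ket b (- a)\<close> is orthogonal to \<open>ket a b\<close>; the
    condition on \<open>a\<close> keeps both vectors nonzero.\<close>
  have disj: "AE l in M. m a b l * m b (- a) l = 0" if "a \<noteq> 0" for a b
    unfolding m_def using that
    by (intro orthogonal_states_disjoint[OF qpr nn] ket_nonzero) (auto simp: ket_cinner)
  \<comment> \<open>Equal mixtures of two orthogonal rays in the plane are all the same state, half
    the projection onto the plane. The common sum is the function \<open>c\<close> of the
    overview.\<close>
  have sum_eq: "m a b l + m b (- a) l = m 1 0 l + m 0 (-1) l" if "l \<in> space M" "a \<noteq> 0" for a b l
  proof -
    have pos: "a\<^sup>2 + b\<^sup>2 > 0" using that by (simp add: sum_power2_gt_zero_iff)
    then have "(1/2) *\<^sub>R ray_proj (ket a b) + (1 - 1/2) *\<^sub>R ray_proj (ket b (- a))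
        = (1/2) *\<^sub>R ray_proj (ket 1 0) + (1 - 1/2) *\<^sub>R ray_proj (ket 0 (-1))"
      unfolding ket_def by (intro ray_proj_mixture_eqI ef)
        (simp_all add: add.commute[of "b\<^sup>2"] add_divide_distrib[symmetric] mult.commute)
    then show ?thesis
      using mix[of a b b "- a" "1/2" l] mix[of 1 0 0 "-1" "1/2" l] that by simp
  qed
  \<comment> \<open>Both sides come from the matrix with rows (4, 2) and (2, 2). Its trace is 6,
    whence the weights \<open>5/6\<close>, \<open>1/6\<close> and \<open>1/3\<close>,
    \<open>2/3\<close>. Taking \<open>ket 0 (-1)\<close> for the second axis matches the companion
    of \<open>ket 1 0\<close> in \<open>sum_eq\<close>.\<close>
  have three: "5 * m 2 1 l + m 0 (-1) l = 2 * m 1 0 l + 4 * m 1 1 l" if "l \<in> space M" for l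
  proof -
    have "(5/6) *\<^sub>R ray_proj (ket 2 1) + (1 - 5/6) *\<^sub>R ray_proj (ket 0 (-1))
        = (1/3) *\<^sub>R ray_proj (ket 1 0) + (1 - 1/3) *\<^sub>R ray_proj (ket 1 1)"
      unfolding ket_def by (intro ray_proj_mixture_eqI ef) simp_all
    then show ?thesis
      using mix[of 2 1 0 "-1" "5/6" l] mix[of 1 0 1 1 "1/3" l] that by simp
  qed
  have "AE l in M. m 1 0 l = 0"
    using disj[of 1 0, simplified] disj[of 1 1, simplified] disj[of 2 1, simplified] AE_space
  proof eventually_elim
    case (elim l)
    then show ?case
      \<comment> \<open>With \<open>c\<close> the common sum, \<open>m 1 1 l\<close> and
        \<open>m 2 1 l\<close> are each \<open>0\<close> or \<open>c\<close>. If
        \<open>m 1 0 l = c\<close>, then \<open>three\<close> equates \<open>0\<close> or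
        \<open>5 * c\<close> with \<open>2 * c\<close> or \<open>6 * c\<close>; if
        \<open>m 1 0 l = 0\<close>, it equates \<open>c\<close> or \<open>6 * c\<close> with
        \<open>0\<close> or \<open>4 * c\<close>. Every case gives \<open>c = 0\<close>.\<close>
      using sum_eq[of l 1 1] sum_eq[of l 2 1] three[of l] by auto
  qed
  then have "(\<integral>l. m 1 0 l \<partial>M) = 0" by (rule integral_eq_zero_AE)
  moreover have "(\<integral>l. m 1 0 l \<partial>M) = 1"
    using qpr density_ray_proj[OF ket_nonzero[of 1 0]]
    by (auto simp: quasiprobability_representation_def m_def)
  ultimately show False by simp
qed

end
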